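(* If $F$ and $G$ are pre-sheaves on a metric space $X$ (with values in a category $\mathbf D$) and $F(X)\ncong G(X)$, then there is no $\epsilon$-interleaving of $F$ and $G$, for any value of $\epsilon$.
   Context: A pre-sheaf on $X$ is a functor $F:\mathbf{Open}(X)^{op}\to\mathbf D$ with restriction maps $\rho_{V,U}:F(U)\to F(V)$ for $V\subseteq U$. For an open set $U\subseteq X$ let $U^\epsilon=\bigcup_{x\in U}B(x,\epsilon)$. The thickened pre-sheaf is $F^\epsilon(U):=F(U^\epsilon)$. For a natural transformation $\varphi$, $\epsilon^*\varphi$ denotes the induced transformation of thickened pre-sheaves. There is a natural transformation $\eta^F_\epsilon:F^\epsilon\to F$ given by restriction $F(U^\epsilon)\to F(U)$. By convention $F^{2\epsilon}$ denotes $U\mapsto F((U^\epsilon)^\epsilon)$ and $\eta^F_{2\epsilon}:F^{2\epsilon}\to F$ the restriction map. An $\epsilon$-interleaving of $F$ and $G$ is a pair of natural transformations $\varphi_\epsilon:F^\epsilon\to G$ and $\psi_\epsilon:G^\epsilon\to F$ such that $\eta^F_{2\epsilon}=\psi_\epsilon\circ\epsilon^*\varphi_\epsilon$ and $\eta^G_{2\epsilon}=\varphi_\epsilon\circ\epsilon^*\psi_\epsilon$. *)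

theory Defs
  imports "HOL-Analysis.Abstract_Metric_Spaces"
begin

section \<open>Categories, functors and natural transformations\<close>

record ('o, 'a) cat =
  Obj :: "'o set"
  Arr :: "'a set"
  Dom :: "'a \<Rightarrow> 'o"
  Cod :: "'a \<Rightarrow> 'o"
  Id :: "'o \<Rightarrow> 'a"
  Comp :: "'a \<Rightarrow> 'a \<Rightarrow> 'a"

text \<open>\<open>Comp C g f\<close> is "g after f"; it is only constrained when the codomain of \<open>f\<close>
  is the domain of \<open>g\<close>.\<close>

definition Hom :: "('o, 'a) cat \<Rightarrow> 'o \<Rightarrow> 'o \<Rightarrow> 'a set" where
  "Hom C A B = {f \<in> Arr C. Dom C f = A \<and> Cod C f = B}"

locale category =
  fixes C :: "('o, 'a) cat"
  assumes Dom_Obj: "f \<in> Arr C \<Longrightarrow> Dom C f \<in> Obj C"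
    and Cod_Obj: "f \<in> Arr C \<Longrightarrow> Cod C f \<in> Obj C"
    and Id_Hom: "A \<in> Obj C \<Longrightarrow> Id C A \<in> Hom C A A"
    and Comp_Hom: "f \<in> Hom C A B \<Longrightarrow> g \<in> Hom C B E \<Longrightarrow> Comp C g f \<in> Hom C A E"
    and Id_right: "f \<in> Hom C A B \<Longrightarrow> Comp C f (Id C A) = f"
    and Id_left: "f \<in> Hom C A B \<Longrightarrow> Comp C (Id C B) f = f"
    and Comp_assoc: "f \<in> Hom C A B \<Longrightarrow> g \<in> Hom C B E \<Longrightarrow> h \<in> Hom C E H \<Longrightarrow>
      Comp C h (Comp C g f) = Comp C (Comp C h g) f"

definition isomorphic_in :: "('o, 'a) cat \<Rightarrow> 'o \<Rightarrow> 'o \<Rightarrow> bool" where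
  "isomorphic_in C A B \<longleftrightarrow>
     (\<exists>f \<in> Hom C A B. \<exists>g \<in> Hom C B A. Comp C g f = Id C A \<and> Comp C f g = Id C B)"

definition opposite :: "('o, 'a) cat \<Rightarrow> ('o, 'a) cat" where
  "opposite C = \<lparr>Obj = Obj C, Arr = Arr C, Dom = Cod C, Cod = Dom C, Id = Id C,
     Comp = (\<lambda>g f. Comp C f g)\<rparr>"

record ('o, 'a, 'p, 'b) func =
  obj_map :: "'o \<Rightarrow> 'p"
  arr_map :: "'a \<Rightarrow> 'b"

locale cat_functor = source: category A + target: category B
  for A :: "('o, 'a) cat" and B :: "('p, 'b) cat" +
  fixes F :: "('o, 'a, 'p, 'b) func"
  assumes obj_map_Obj: "X \<in> Obj A \<Longrightarrow> obj_map F X \<in> Obj B"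
    and arr_map_Hom: "f \<in> Hom A X Y \<Longrightarrow> arr_map F f \<in> Hom B (obj_map F X) (obj_map F Y)"
    and arr_map_Id: "X \<in> Obj A \<Longrightarrow> arr_map F (Id A X) = Id B (obj_map F X)"
    and arr_map_Comp: "f \<in> Hom A X Y \<Longrightarrow> g \<in> Hom A Y Z \<Longrightarrow>
      arr_map F (Comp A g f) = Comp B (arr_map F g) (arr_map F f)"

definition func_comp ::
    "('p, 'b, 'q, 'c) func \<Rightarrow> ('o, 'a, 'p, 'b) func \<Rightarrow> ('o, 'a, 'q, 'c) func" where
  "func_comp G F = \<lparr>obj_map = obj_map G \<circ> obj_map F, arr_map = arr_map G \<circ> arr_map F\<rparr>"

locale nat_trans = F: cat_functor A B F + G: cat_functor A B G
  for A :: "('o, 'a) cat" and B :: "('p, 'b) cat"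
    and F :: "('o, 'a, 'p, 'b) func" and G :: "('o, 'a, 'p, 'b) func" +
  fixes \<alpha> :: "'o \<Rightarrow> 'b"
  assumes component_Hom: "X \<in> Obj A \<Longrightarrow> \<alpha> X \<in> Hom B (obj_map F X) (obj_map G X)"
    and naturality: "f \<in> Hom A X Y \<Longrightarrow>
      Comp B (\<alpha> Y) (arr_map F f) = Comp B (arr_map G f) (\<alpha> X)"

text \<open>Components outside \<open>Obj A\<close> are junk values, so equality of natural transformations
  with source category \<open>A\<close> is equality of components on \<open>Obj A\<close>.\<close>

definition nat_eq :: "('o, 'a) cat \<Rightarrow> ('o \<Rightarrow> 'b) \<Rightarrow> ('o \<Rightarrow> 'b) \<Rightarrow> bool" where
  "nat_eq A \<alpha> \<beta> \<longleftrightarrow> (\<forall>X \<in> Obj A. \<alpha> X = \<beta> X)"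

definition nat_comp :: "('p, 'b) cat \<Rightarrow> ('o \<Rightarrow> 'b) \<Rightarrow> ('o \<Rightarrow> 'b) \<Rightarrow> 'o \<Rightarrow> 'b" where
  "nat_comp B \<beta> \<alpha> = (\<lambda>X. Comp B (\<beta> X) (\<alpha> X))"


section \<open>Presheaves\<close>

text \<open>The pair \<open>(V, U)\<close> encodes the inclusion of \<open>V\<close> into \<open>U\<close>.\<close>

definition Opens :: "'x topology \<Rightarrow> ('x set, 'x set \<times> 'x set) cat" where
  "Opens T = \<lparr>Obj = {U. openin T U},
     Arr = {(V, U). openin T V \<and> openin T U \<and> V \<subseteq> U},
     Dom = fst, Cod = snd, Id = (\<lambda>U. (U, U)), Comp = (\<lambda>g f. (fst f, snd g))\<rparr>"

type_synonym ('x, 'o, 'a) psh = "('x set, 'x set \<times> 'x set, 'o, 'a) func"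

abbreviation presheaf :: "'x topology \<Rightarrow> ('o, 'a) cat \<Rightarrow> ('x, 'o, 'a) psh \<Rightarrow> bool" where
  "presheaf T D F \<equiv> cat_functor (opposite (Opens T)) D F"

definition restriction :: "('x, 'o, 'a) psh \<Rightarrow> 'x set \<Rightarrow> 'x set \<Rightarrow> 'a" where
  "restriction F V U = arr_map F (V, U)"


section \<open>Thickenings and interleavings\<close>

context Metric_space
begin

definition thicken :: "real \<Rightarrow> 'a set \<Rightarrow> 'a set" where
  "thicken \<epsilon> U = (\<Union>x\<in>U. mball x \<epsilon>)"

text \<open>Thickening is monotone, hence an endofunctor of the category of open sets; the same
  data describe the induced endofunctor of the opposite category.\<close>

definition thicken_functor :: "real \<Rightarrow> ('a, 'a set, 'a set \<times> 'a set) psh" where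
  "thicken_functor \<epsilon> = \<lparr>obj_map = thicken \<epsilon>, arr_map = map_prod (thicken \<epsilon>) (thicken \<epsilon>)\<rparr>"

definition thickened :: "real \<Rightarrow> ('a, 'o, 'm) psh \<Rightarrow> ('a, 'o, 'm) psh" where
  "thickened \<epsilon> F = func_comp F (thicken_functor \<epsilon>)"

definition pullback :: "real \<Rightarrow> ('a set \<Rightarrow> 'm) \<Rightarrow> 'a set \<Rightarrow> 'm" where
  "pullback \<epsilon> \<phi> = (\<lambda>U. \<phi> (thicken \<epsilon> U))"

text \<open>The transformation from the twice thickened presheaf to \<open>F\<close>; it is meaningful for
  \<open>\<epsilon> > 0\<close> only, since open balls of radius at most \<open>0\<close> are empty.\<close>

definition eta_twice :: "real \<Rightarrow> ('a, 'o, 'm) psh \<Rightarrow> 'a set \<Rightarrow> 'm" where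
  "eta_twice \<epsilon> F = (\<lambda>U. restriction F U (thicken \<epsilon> (thicken \<epsilon> U)))"

definition interleaving :: "('o, 'm) cat \<Rightarrow> real \<Rightarrow> ('a, 'o, 'm) psh \<Rightarrow> ('a, 'o, 'm) psh \<Rightarrow>
    ('a set \<Rightarrow> 'm) \<Rightarrow> ('a set \<Rightarrow> 'm) \<Rightarrow> bool" where
  "interleaving D \<epsilon> F G \<phi> \<psi> \<longleftrightarrow>
     nat_trans (opposite (Opens mtopology)) D (thickened \<epsilon> F) G \<phi> \<and>
     nat_trans (opposite (Opens mtopology)) D (thickened \<epsilon> G) F \<psi> \<and>
     nat_eq (opposite (Opens mtopology)) (eta_twice \<epsilon> F) (nat_comp D \<psi> (pullback \<epsilon> \<phi>)) \<and>
     nat_eq (opposite (Opens mtopology)) (eta_twice \<epsilon> G) (nat_comp D \<phi> (pullback \<epsilon> \<psi>))"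

end

end

theory Submission imports Defs begin

text \<open>
  Thickening by \<open>\<epsilon> > 0\<close> does not change the whole space \<open>M\<close>. Hence at \<open>M\<close> the components of an
  interleaving are morphisms between \<open>F(M)\<close> and \<open>G(M)\<close>, and both \<open>\<eta>\<close>-maps are restrictions from
  \<open>M\<close> to itself, i.e. identities: the two interleaving equations say that the components are
  mutually inverse.
\<close>

text \<open>Balls lie inside \<open>M\<close>, and a ball of positive radius contains its
  centre.\<close>

lemma (in Metric_space) thicken_space:
  assumes "\<epsilon> > 0"
  shows "thicken \<epsilon> M = M"
  using assms centre_in_mball_iff by (auto simp: thicken_def)

text \<open>The pair \<open>(U, U)\<close> is the identity arrow of \<open>U\<close>, and functors
  preserve identities.\<close>

lemma restriction_self:
  assumes "presheaf T D F" and "openin T U"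
  shows "restriction F U U = Id D (obj_map F U)"
  using cat_functor.arr_map_Id[OF assms(1), of U] assms(2)
  by (simp add: restriction_def opposite_def Opens_def)

lemma (in Metric_space) interleaving_imp_isomorphic_global_sections:
  assumes F: "presheaf mtopology D F" and G: "presheaf mtopology D G"
    and "\<epsilon> > 0" and I: "interleaving D \<epsilon> F G \<phi> \<psi>"
  shows "isomorphic_in D (obj_map F M) (obj_map G M)"
proof -
  note thick = thicken_space[OF \<open>\<epsilon> > 0\<close>]
  have M_open: "openin mtopology M"
    using openin_topspace[of mtopology] by simp
  hence M: "M \<in> Obj (opposite (Opens mtopology))"
    by (simp add: opposite_def Opens_def)
  have at_M: "obj_map (thickened \<epsilon> H) M = obj_map H M" for H :: "('a, 'o, 'm) psh"
    by (simp add: thickened_def func_comp_def thicken_functor_def thick)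
  have "\<phi> M \<in> Hom D (obj_map F M) (obj_map G M)" "\<psi> M \<in> Hom D (obj_map G M) (obj_map F M)"
    using I nat_trans.component_Hom[OF _ M] at_M unfolding interleaving_def by metis+
  moreover have "eta_twice \<epsilon> F M = nat_comp D \<psi> (pullback \<epsilon> \<phi>) M"
      "eta_twice \<epsilon> G M = nat_comp D \<phi> (pullback \<epsilon> \<psi>) M"
    using I M unfolding interleaving_def nat_eq_def by blast+
  \<comment> \<open>Since \<open>thicken \<epsilon> M = M\<close>, \<open>pullback\<close> leaves
    the component at \<open>M\<close> unchanged and \<open>eta_twice\<close> at \<open>M\<close>
    restricts from \<open>M\<close> to \<open>M\<close>.\<close>
  hence "Comp D (\<psi> M) (\<phi> M) = Id D (obj_map F M)"
      "Comp D (\<phi> M) (\<psi> M) = Id D (obj_map G M)"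
    using restriction_self[OF F M_open] restriction_self[OF G M_open]
    by (simp_all add: nat_comp_def pullback_def eta_twice_def thick)
  ultimately show ?thesis
    unfolding isomorphic_in_def by blast
qed

theorem lemma15p1p12:
  fixes M :: "'x set" and d :: "'x \<Rightarrow> 'x \<Rightarrow> real"
    and D :: "('o, 'm) cat" and F G :: "('x, 'o, 'm) psh"
  assumes "Metric_space M d"
    and "category D"
    and "presheaf (Metric_space.mtopology M d) D F"
    and "presheaf (Metric_space.mtopology M d) D G"
    and "\<not> isomorphic_in D (obj_map F M) (obj_map G M)"
  shows "\<forall>\<epsilon>>0. \<not> (\<exists>\<phi> \<psi>. Metric_space.interleaving M d D \<epsilon> F G \<phi> \<psi>)"
  using Metric_space.interleaving_imp_isomorphic_global_sections[OF assms(1,3,4)] assms(5)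
  by blast

end
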